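(* Let $\alpha>0$, let $\widehat\theta^{\,\mathrm{p}}>0$ be a deterministic value, and let $\theta_0>0$. Let $X_1,X_2,\dots$ be i.i.d. uniform on $[0,\theta_0]$ and let $Z_1,Z_2,\dots\in\{0,1\}$ be the public views of $X_1,X_2,\dots$ drawn independently according to the channel $$P(Z=z\mid X=x)=\begin{cases}\frac{1}{1+e^\alpha}\left(e^\alpha\mathbf{1}_{\{1\}}(z)+\mathbf{1}_{\{0\}}(z)\right)&\text{if }x\in[0,\widehat\theta^{\,\mathrm{p}}),\\[2pt]\frac{1}{1+e^\alpha}\left(\mathbf{1}_{\{1\}}(z)+e^\alpha\mathbf{1}_{\{0\}}(z)\right)&\text{if }x\in[\widehat\theta^{\,\mathrm{p}},\infty).\end{cases}$$ Let $\overline Z_n=\frac1n\sum_{i=1}^nZ_i$ and $$\widehat\theta_n:=\widehat\theta^{\,\mathrm{p}}\,\frac{e^\alpha-1}{(1+e^\alpha)\overline Z_n-1}.$$ Then: 1) $\widehat\theta_n\to\theta_0\vee\widehat\theta^{\,\mathrm{p}}$ almost surely as $n\to\infty$. 2) If $\widehat\theta^{\,\mathrm{p}}\le\theta_0$, the estimator is consistent and $\sqrt n\left(\widehat\theta_n-\theta_0\right)$ converges in law, as $n\to\infty$, to $\mathcal{N}\left(0,v(\theta_0,\widehat\theta^{\,\mathrm{p}})\right)$, where $$v(\theta_0,\widehat\theta^{\,\mathrm{p}})=\frac{\theta_0^4}{(\widehat\theta^{\,\mathrm{p}})^2}\frac{1}{(e^\alpha-1)^2}\left[1+(e^\alpha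-1)\frac{\widehat\theta^{\,\mathrm{p}}}{\theta_0}\right]\left[e^\alpha-(e^\alpha-1)\frac{\widehat\theta^{\,\mathrm{p}}}{\theta_0}\right].$$
   Context: The pairs $(X_i,Z_i)$ are i.i.d.; $a\vee b=\max(a,b)$. On the event where the denominator in $\widehat\theta_n$ vanishes (which a.s. occurs for at most finitely many $n$), $\widehat\theta_n$ may be given any fixed value. *)

theory Defs
  imports "HOL-Probability.Probability"
begin

(* Mass function of the channel, P(Z = z | X = x), for z in {0, 1}. The channel is specified
   for x >= 0 only; the second branch is also used for x < 0, where X has no mass. *)
definition channel :: "real \<Rightarrow> real \<Rightarrow> real \<Rightarrow> nat \<Rightarrow> real" where
  "channel \<alpha> \<theta>p x z =
     (if x \<in> {0..<\<theta>p}
      then 1 / (1 + exp \<alpha>) * (exp \<alpha> * indicator {1} z + indicator {0} z)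
      else 1 / (1 + exp \<alpha>) * (indicator {1} z + exp \<alpha> * indicator {0} z))"

(* Sequences are indexed from 0: Z i stands for the (i+1)-st observation. *)
definition sample_mean :: "(nat \<Rightarrow> 'a \<Rightarrow> nat) \<Rightarrow> nat \<Rightarrow> 'a \<Rightarrow> real" where
  "sample_mean Z n \<omega> = (\<Sum>i<n. real (Z i \<omega>)) / real n"

(* The parameter c is the arbitrary fixed value taken where the denominator vanishes. *)
definition estimator :: "real \<Rightarrow> real \<Rightarrow> real \<Rightarrow> (nat \<Rightarrow> 'a \<Rightarrow> nat) \<Rightarrow> nat \<Rightarrow> 'a \<Rightarrow> real" where
  "estimator c \<alpha> \<theta>p Z n \<omega> =
     (if (1 + exp \<alpha>) * sample_mean Z n \<omega> - 1 = 0 then c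
      else \<theta>p * ((exp \<alpha> - 1) / ((1 + exp \<alpha>) * sample_mean Z n \<omega> - 1)))"

definition asymptotic_variance :: "real \<Rightarrow> real \<Rightarrow> real \<Rightarrow> real" where
  "asymptotic_variance \<alpha> \<theta>0 \<theta>p =
     \<theta>0 ^ 4 / \<theta>p ^ 2 * (1 / (exp \<alpha> - 1) ^ 2)
       * (1 + (exp \<alpha> - 1) * (\<theta>p / \<theta>0)) * (exp \<alpha> - (exp \<alpha> - 1) * (\<theta>p / \<theta>0))"

definition converges_in_probability :: "'a measure \<Rightarrow> (nat \<Rightarrow> 'a \<Rightarrow> real) \<Rightarrow> real \<Rightarrow> bool" where
  "converges_in_probability M Y l \<longleftrightarrow>
     (\<forall>\<epsilon>>0. (\<lambda>n. measure M {\<omega> \<in> space M. \<bar>Y n \<omega> - l\<bar> > \<epsilon>}) \<longlonglongrightarrow> 0)"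

(* The second parameter is the variance, whereas normal_density expects the standard deviation. *)
definition normal_law :: "real \<Rightarrow> real \<Rightarrow> real measure" where
  "normal_law \<mu> v = density lborel (\<lambda>x. ennreal (normal_density \<mu> (sqrt v) x))"

end

theory Submission
  imports Defs
begin

text \<open>
  Put \<open>\<theta> = max \<theta>0 \<theta>p\<close>. Integrating the channel against the uniform law of \<open>X\<close> shows that the
  public views are independent Bernoulli variables with parameter
  \<open>p = (1 + d) / (1 + exp \<alpha>)\<close>, where \<open>d = (exp \<alpha> - 1) * \<theta>p / \<theta>\<close> is positive. The estimator is
  \<open>\<theta> * d / D\<^sub>n\<close> with \<open>D\<^sub>n = (1 + exp \<alpha>) * Zbar\<^sub>n - 1\<close>, so the first claim
  follows from \<open>D\<^sub>n \<longlonglongrightarrow> d\<close>. This is the strong law of large numbers, which for bounded variables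
  follows from Hoeffding's inequality and the Borel--Cantelli lemma. Consistency is then the fact
  that almost sure convergence implies convergence in probability.

  For the limit law, let \<open>W\<^sub>n\<close> be the standardised sum of the variables \<open>p - Z\<^sub>i\<close>, which is
  asymptotically standard normal by the central limit theorem. The scaled error
  \<open>sqrt n * (\<theta> * d / D\<^sub>n - \<theta>)\<close> is an increasing function of \<open>W\<^sub>n\<close> on the set where \<open>D\<^sub>n > 0\<close>,
  for it equals \<open>\<theta> * s * W\<^sub>n / (d - s * W\<^sub>n / sqrt n)\<close> with \<open>s = (1 + exp \<alpha>) * sqrt (p * (1 - p))\<close>.
  Hence the event that it is at most \<open>x\<close> agrees, for large \<open>n\<close> and up to an event whose
  probability vanishes, with the event that \<open>W\<^sub>n\<close> is at most a deterministic threshold, and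
  this threshold tends to \<open>x * d / (s * \<theta>)\<close>. As the normal distribution function is continuous,
  the probability tends to its value there, which is the distribution function at \<open>x\<close> of the
  normal law with variance \<open>(\<theta> * s / d)\<^sup>2\<close>. This monotonicity takes the place of
  Slutsky's lemma and of the delta method.
\<close>

section \<open>Almost sure convergence and the strong law for bounded variables\<close>

lemma (in prob_space) AE_eventually_not_imp_prob_tendsto_0:
  fixes A :: "nat \<Rightarrow> 'a set"
  assumes A [measurable]: "\<And>n. A n \<in> events"
    and ev: "AE \<omega> in M. eventually (\<lambda>n. \<omega> \<notin> A n) sequentially"
  shows "(\<lambda>n. prob (A n)) \<longlonglongrightarrow> 0"
proof -
  have "(\<lambda>n. \<integral>\<omega>. indicator (A n) \<omega> \<partial>M) \<longlonglongrightarrow> (\<integral>\<omega>. (0::real) \<partial>M)"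
  proof (rule integral_dominated_convergence[where w = "\<lambda>_. 1"])
    show "AE \<omega> in M. (\<lambda>n. indicator (A n) \<omega> :: real) \<longlonglongrightarrow> 0"
      using ev
    proof eventually_elim
      case (elim \<omega>)
      show ?case
        by (rule tendsto_eventually, use elim in eventually_elim) simp
    qed
  qed (auto simp: indicator_def)
  then show ?thesis by simp
qed

text \<open>
  Hoeffding's inequality bounds the probability that the mean deviates by \<open>\<epsilon>\<close> or more by a term of
  a geometric series, so by Borel--Cantelli almost surely only finitely many such deviations occur.
  The variables need not be identically distributed.
\<close>

theorem (in prob_space) strong_law_bounded:
  fixes X :: "nat \<Rightarrow> 'a \<Rightarrow> real"
  assumes indep: "indep_vars (\<lambda>_. borel) X UNIV"
    and bnd: "\<And>i. AE \<omega> in M. X i \<omega> \<in> {a..b}"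
    and mean: "\<And>i. expectation (X i) = m"
  shows "AE \<omega> in M. (\<lambda>n. (\<Sum>i<n. X i \<omega>) / real n) \<longlonglongrightarrow> m"
proof -
  \<comment> \<open>The interval is enlarged to have positive length, so that the bound below makes sense.\<close>
  define b' where "b' = max b (a + 1)"
  have len: "b' - a > 0" by (simp add: b'_def)
  have rv [measurable]: "random_variable borel (X i)" for i
    using indep by (simp add: indep_vars_def2)
  define S where "S n \<omega> = (\<Sum>i<n. X i \<omega>)" for n \<omega>
  have S_rv [measurable]: "random_variable borel (S n)" for n
    unfolding S_def by measurable
  have tail: "prob {\<omega> \<in> space M. \<bar>S n \<omega> - real n * m\<bar> \<ge> real n * \<epsilon>}
                \<le> 2 * exp (-2 * \<epsilon>\<^sup>2 / (b' - a)\<^sup>2) ^ n"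
    if \<epsilon>: "\<epsilon> > 0" for \<epsilon> n
  proof (cases "n = 0")
    case True
    then show ?thesis by (simp add: prob_space)
  next
    case False
    interpret H: Hoeffding_ineq M "{..<n}" X "\<lambda>_. a" "\<lambda>_. b'" "\<Sum>i<n. expectation (X i)"
    proof unfold_locales
      show "indep_vars (\<lambda>_. borel) X {..<n}"
        by (rule indep_vars_subset[OF indep]) auto
      show "AE \<omega> in M. X i \<omega> \<in> {a..b'}" for i
        using bnd[of i] by eventually_elim (auto simp: b'_def)
    qed simp_all
    have "prob {\<omega> \<in> space M. \<bar>S n \<omega> - real n * m\<bar> \<ge> real n * \<epsilon>}
            \<le> 2 * exp (-2 * (real n * \<epsilon>)\<^sup>2 / (real n * (b' - a)\<^sup>2))"
      using H.Hoeffding_ineq_abs_ge[of "real n * \<epsilon>"] \<epsilon> False len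
      by (simp add: S_def mean)
    also have "-2 * (real n * \<epsilon>)\<^sup>2 / (real n * (b' - a)\<^sup>2) = real n * (-2 * \<epsilon>\<^sup>2 / (b' - a)\<^sup>2)"
      using False by (simp add: power2_eq_square)
    finally show ?thesis by (simp only: exp_of_nat_mult)
  qed
  have dev: "AE \<omega> in M. eventually (\<lambda>n. \<bar>S n \<omega> - real n * m\<bar> < real n * \<epsilon>) sequentially"
    if \<epsilon>: "\<epsilon> > 0" for \<epsilon>
  proof -
    let ?A = "\<lambda>n. {\<omega> \<in> space M. \<bar>S n \<omega> - real n * m\<bar> \<ge> real n * \<epsilon>}"
    have "exp (-2 * \<epsilon>\<^sup>2 / (b' - a)\<^sup>2) < 1"
      using \<epsilon> len by simp
    then have "summable (\<lambda>n. 2 * exp (-2 * \<epsilon>\<^sup>2 / (b' - a)\<^sup>2) ^ n)"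
      by (intro summable_mult summable_geometric) simp
    then have "summable (\<lambda>n. prob (?A n))"
      by (rule summable_comparison_test') (use tail[OF \<epsilon>] in simp)
    then have "AE \<omega> in M. eventually (\<lambda>n. \<omega> \<in> space M - ?A n) sequentially"
      by (intro borel_cantelli_AE1) (auto simp: emeasure_eq_measure)
    then show ?thesis
      by eventually_elim (auto elim!: eventually_mono)
  qed
  have "AE \<omega> in M. \<forall>k. eventually (\<lambda>n. \<bar>S n \<omega> - real n * m\<bar> < real n * (1 / real (Suc k))) sequentially"
    unfolding AE_all_countable by (intro allI dev) simp
  then show ?thesis
  proof eventually_elim
    case (elim \<omega>)
    show ?case
    proof (rule tendstoI)
      fix e :: real assume "e > 0"
      then obtain k where k: "1 / real (Suc k) < e"
        using nat_approx_posE by blast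
      show "eventually (\<lambda>n. dist ((\<Sum>i<n. X i \<omega>) / real n) m < e) sequentially"
        using elim[rule_format, of k] eventually_gt_at_top[of 0]
      proof eventually_elim
        case (elim n)
        have "(\<Sum>i<n. X i \<omega>) / real n - m = (S n \<omega> - real n * m) / real n"
          using elim(2) by (simp add: S_def diff_divide_distrib)
        then have "dist ((\<Sum>i<n. X i \<omega>) / real n) m = \<bar>S n \<omega> - real n * m\<bar> / real n"
          by (simp add: dist_real_def abs_divide)
        also have "\<dots> < 1 / real (Suc k)"
          using elim by (simp add: divide_less_eq mult.commute)
        finally show ?case using k by simp
      qed
    qed
  qed
qed

section \<open>Distribution functions and the normal law\<close>

text \<open>
  Pointwise convergence of distribution functions to a continuous limit is continuous convergence:
  the argument may vary with \<open>n\<close>. By monotonicity it suffices to compare at two fixed points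
  close to \<open>l\<close> on either side.
\<close>

lemma weak_conv_m_cdf_tendsto:
  fixes \<mu> :: "nat \<Rightarrow> real measure" and x :: "nat \<Rightarrow> real"
  assumes conv: "weak_conv_m \<mu> \<nu>"
    and dist: "\<And>n. real_distribution (\<mu> n)"
    and cont: "\<And>y. isCont (cdf \<nu>) y"
    and lim: "x \<longlonglongrightarrow> l"
  shows "(\<lambda>n. cdf (\<mu> n) (x n)) \<longlonglongrightarrow> cdf \<nu> l"
proof (rule LIMSEQ_I)
  have ptw: "(\<lambda>n. cdf (\<mu> n) y) \<longlonglongrightarrow> cdf \<nu> y" for y
    using conv cont by (simp add: weak_conv_m_def weak_conv_def)
  have mono: "y \<le> z \<Longrightarrow> cdf (\<mu> n) y \<le> cdf (\<mu> n) z" for n y z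
  proof -
    interpret real_distribution "\<mu> n" by (rule dist)
    show "y \<le> z \<Longrightarrow> cdf (\<mu> n) y \<le> cdf (\<mu> n) z" by (rule cdf_nondecreasing)
  qed
  fix e :: real assume e: "e > 0"
  then obtain d where d: "d > 0" "\<And>y. \<bar>y - l\<bar> < d \<Longrightarrow> \<bar>cdf \<nu> y - cdf \<nu> l\<bar> < e / 2"
    using cont[of l] unfolding continuous_at_eps_delta dist_real_def
    by (metis half_gt_zero)
  have "eventually (\<lambda>n. \<bar>x n - l\<bar> < d / 2) sequentially"
    using lim d(1) by (auto simp: tendsto_iff dist_real_def dest: spec[of _ "d / 2"])
  moreover have "eventually (\<lambda>n. \<bar>cdf (\<mu> n) y - cdf \<nu> y\<bar> < e / 2) sequentially" for y
    using ptw[of y] e by (auto simp: tendsto_iff dist_real_def dest: spec[of _ "e / 2"])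
  note this[of "l - d / 2"] this[of "l + d / 2"]
  ultimately have "eventually (\<lambda>n. norm (cdf (\<mu> n) (x n) - cdf \<nu> l) < e) sequentially"
  proof eventually_elim
    case (elim n)
    have "cdf (\<mu> n) (l - d / 2) \<le> cdf (\<mu> n) (x n)" "cdf (\<mu> n) (x n) \<le> cdf (\<mu> n) (l + d / 2)"
      by (intro mono, use elim(1) in arith)+
    moreover have "\<bar>cdf \<nu> (l - d / 2) - cdf \<nu> l\<bar> < e / 2" "\<bar>cdf \<nu> (l + d / 2) - cdf \<nu> l\<bar> < e / 2"
      using d by auto
    ultimately show ?case using elim(2,3) unfolding real_norm_def by arith
  qed
  then show "\<exists>N. \<forall>n\<ge>N. norm (cdf (\<mu> n) (x n) - cdf \<nu> l) < e"
    by (simp add: eventually_sequentially)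
qed

lemma isCont_cdf_std_normal: "isCont (cdf std_normal_distribution) x"
proof -
  interpret real_distribution std_normal_distribution by (rule real_dist_normal_dist)
  have "emeasure std_normal_distribution {x} = 0"
    by (subst emeasure_density) (auto intro!: nn_integral_null_set simp: null_sets_def)
  then show ?thesis by (simp add: isCont_cdf measure_def)
qed

lemma cdf_normal_law:
  assumes "\<tau> > 0"
  shows "cdf (normal_law 0 (\<tau>\<^sup>2)) x = cdf std_normal_distribution (x / \<tau>)"
proof -
  interpret real_distribution std_normal_distribution by (rule real_dist_normal_dist)
  have "distributed std_normal_distribution lborel (\<lambda>x. x) std_normal_density"
    by (auto simp: distributed_def intro!: distr_id2)
  from normal_density_affine[OF this, of \<tau> 0] assms
  have "distributed std_normal_distribution lborel (\<lambda>x. \<tau> * x) (normal_density 0 \<tau>)"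
    by simp
  then have law: "normal_law 0 (\<tau>\<^sup>2) = distr std_normal_distribution lborel (\<lambda>x. \<tau> * x)"
    using assms by (simp add: distributed_def normal_law_def)
  have "cdf (normal_law 0 (\<tau>\<^sup>2)) x = measure std_normal_distribution ((\<lambda>y. \<tau> * y) -` {..x} \<inter> UNIV)"
    unfolding cdf_def law by (subst measure_distr) auto
  also have "(\<lambda>y. \<tau> * y) -` {..x} \<inter> UNIV = {..x / \<tau>}"
    using assms by (auto simp: field_simps)
  finally show ?thesis by (simp add: cdf_def)
qed

section \<open>The law of a single public view\<close>

lemma (in prob_space) expectation_zero_one:
  fixes Z :: "'a \<Rightarrow> nat" and f :: "nat \<Rightarrow> real"
  assumes Z [measurable]: "random_variable (count_space UNIV) Z"
    and Z01: "\<And>\<omega>. \<omega> \<in> space M \<Longrightarrow> Z \<omega> \<in> {0, 1}"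
    and p: "prob {\<omega> \<in> space M. Z \<omega> = 1} = p"
  shows "expectation (\<lambda>\<omega>. f (Z \<omega>)) = (1 - p) * f 0 + p * f 1"
proof -
  let ?A = "{\<omega> \<in> space M. Z \<omega> = 1}"
  have [measurable]: "?A \<in> events" by measurable
  have int: "integrable M (indicator ?A :: 'a \<Rightarrow> real)"
    by (intro integrable_real_indicator) (auto simp: emeasure_eq_measure)
  have "expectation (\<lambda>\<omega>. f (Z \<omega>)) = expectation (\<lambda>\<omega>. f 0 + (f 1 - f 0) * indicator ?A \<omega>)"
    using Z01 by (intro Bochner_Integration.integral_cong) (fastforce simp: indicator_def)+
  also have "\<dots> = f 0 + (f 1 - f 0) * p"
    using int p by (subst Bochner_Integration.integral_add) (auto simp: prob_space)
  finally show ?thesis by (simp add: algebra_simps)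
qed

text \<open>
  The law of total probability: the mean of the conditional probability given \<open>X\<close> is the
  unconditional one, and the channel takes only two values, according to
  whether \<open>X\<close> lies in \<open>[0, \<theta>p)\<close>.
\<close>

lemma (in prob_space) prob_one_channel:
  fixes X :: "'a \<Rightarrow> real" and Z :: "'a \<Rightarrow> nat"
  assumes X [measurable]: "random_variable borel X"
    and Z [measurable]: "random_variable (count_space UNIV) Z"
    and unif: "distr M borel X = uniform_measure lborel {0..\<theta>0}"
    and pos: "\<theta>0 > 0" "\<theta>p > 0"
    and chan: "AE \<omega> in M. real_cond_exp M (vimage_algebra (space M) X borel)
                 (indicator {\<omega> \<in> space M. Z \<omega> = 1}) \<omega> = channel \<alpha> \<theta>p (X \<omega>) 1"
  shows "prob {\<omega> \<in> space M. Z \<omega> = 1} = (1 + (exp \<alpha> - 1) * (min \<theta>0 \<theta>p / \<theta>0)) / (1 + exp \<alpha>)"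
proof -
  let ?F = "vimage_algebra (space M) X borel"
  let ?A = "{\<omega> \<in> space M. Z \<omega> = 1}"
  let ?B = "{\<omega> \<in> space M. X \<omega> \<in> {0..<\<theta>p}}"
  have [measurable]: "?A \<in> events" by measurable
  have int: "integrable M (indicator ?A :: 'a \<Rightarrow> real)"
    by (intro integrable_real_indicator) (auto simp: emeasure_eq_measure)
  have [measurable]: "?B \<in> events" by measurable
  have intB: "integrable M (indicator ?B :: 'a \<Rightarrow> real)"
    by (intro integrable_real_indicator) (auto simp: emeasure_eq_measure)
  have "subalgebra M ?F"
    using X by (auto simp: subalgebra_def sets_vimage_algebra2 measurable_sets)
  then interpret F: finite_measure_subalgebra M ?F
    by unfold_locales
  have "prob ?B = measure (distr M borel X) {0..<\<theta>p}"
    by (subst measure_distr) (auto intro!: arg_cong[where f = prob])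
  also have "\<dots> = measure lborel ({0..\<theta>0} \<inter> {0..<\<theta>p}) / measure lborel {0..\<theta>0}"
    unfolding unif using pos by (subst measure_uniform_measure) auto
  also have "measure lborel ({0..\<theta>0} \<inter> {0..<\<theta>p}) = min \<theta>0 \<theta>p"
  proof (cases "\<theta>p \<le> \<theta>0")
    case True
    then have "{0..\<theta>0} \<inter> {0..<\<theta>p} = {0..<\<theta>p}" by auto
    then show ?thesis using pos True by simp
  next
    case False
    then have "{0..\<theta>0} \<inter> {0..<\<theta>p} = {0..\<theta>0}" by auto
    then show ?thesis using pos False by simp
  qed
  finally have B: "prob ?B = min \<theta>0 \<theta>p / \<theta>0"
    using pos by simp
  have "prob ?A = (\<integral>\<omega>. indicator ?A \<omega> \<partial>M)"
    by simp
  also have "\<dots> = (\<integral>\<omega>. real_cond_exp M ?F (indicator ?A) \<omega> \<partial>M)"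
    by (rule F.real_cond_exp_int(2)[OF int, symmetric])
  also have "\<dots> = (\<integral>\<omega>. channel \<alpha> \<theta>p (X \<omega>) 1 \<partial>M)"
    by (rule integral_cong_AE) (use chan in \<open>auto simp: channel_def\<close>)
  also have "\<dots> = (\<integral>\<omega>. 1 / (1 + exp \<alpha>) + (exp \<alpha> - 1) / (1 + exp \<alpha>) * indicator ?B \<omega> \<partial>M)"
    by (intro Bochner_Integration.integral_cong)
       (auto simp: channel_def indicator_def simp flip: add_divide_distrib)
  also have "\<dots> = 1 / (1 + exp \<alpha>) + (exp \<alpha> - 1) / (1 + exp \<alpha>) * prob ?B"
    using intB by (subst Bochner_Integration.integral_add) (auto simp: prob_space)
  finally show ?thesis
    unfolding B by (simp add: add_divide_distrib)
qed


section \<open>The estimator for independent Bernoulli views\<close>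

text \<open>
  Independent public views with the success probability that results from a uniform sample on
  an interval \<open>[0, \<theta>0]\<close>. The parameter \<open>\<theta>\<close> is \<open>max \<theta>0 \<theta>p\<close>, which is all that the
  law of the views retains of \<open>\<theta>0\<close>; hence the condition \<open>\<theta>p \<le> \<theta>\<close>. The sample itself does not
  occur. The constant \<open>c\<close> is the value of the estimator where its denominator vanishes.
\<close>

locale private_bits = prob_space M for M :: "'a measure" +
  fixes Z :: "nat \<Rightarrow> 'a \<Rightarrow> nat" and \<alpha> \<theta>p \<theta> c :: real
  assumes indep_Z: "indep_vars (\<lambda>_. count_space UNIV) Z UNIV"
    and Z01: "\<And>i \<omega>. \<omega> \<in> space M \<Longrightarrow> Z i \<omega> \<in> {0, 1}"
    and prob_Z: "\<And>i. prob {\<omega> \<in> space M. Z i \<omega> = 1} = (1 + (exp \<alpha> - 1) * (\<theta>p / \<theta>)) / (1 + exp \<alpha>)"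
    and \<alpha>_pos: "\<alpha> > 0" and \<theta>p_pos: "\<theta>p > 0" and \<theta>p_le: "\<theta>p \<le> \<theta>"
begin

text \<open>The success probability of a public view.\<close>

definition p :: real where "p = (1 + (exp \<alpha> - 1) * (\<theta>p / \<theta>)) / (1 + exp \<alpha>)"

text \<open>The limit of the denominator of the estimator.\<close>

definition d :: real where "d = (exp \<alpha> - 1) * (\<theta>p / \<theta>)"

text \<open>The denominator of the estimator.\<close>

definition D :: "nat \<Rightarrow> 'a \<Rightarrow> real" where "D n \<omega> = (1 + exp \<alpha>) * sample_mean Z n \<omega> - 1"

text \<open>
  The standardised sum of the centred views. The sign is reversed, so that the error of the
  estimator increases with it.
\<close>

definition W :: "nat \<Rightarrow> 'a \<Rightarrow> real" where
  "W n \<omega> = (\<Sum>i<n. p - real (Z i \<omega>)) / sqrt (real n * (sqrt (p * (1 - p)))\<^sup>2)"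

lemma \<theta>_pos: "\<theta> > 0"
  using \<theta>p_pos \<theta>p_le by simp

lemma d_pos: "d > 0"
  using \<alpha>_pos \<theta>p_pos \<theta>_pos by (simp add: d_def)

lemma d_eq: "(1 + exp \<alpha>) * p - 1 = d"
proof -
  have "1 + exp \<alpha> \<noteq> 0" using exp_gt_zero[of \<alpha>] by linarith
  then show ?thesis by (simp add: p_def d_def)
qed

lemma p_pos: "p > 0"
  using d_pos exp_gt_zero[of \<alpha>] d_eq by (smt (verit) zero_less_mult_iff)

lemma p_less_1: "p < 1"
proof -
  have "d \<le> (exp \<alpha> - 1) * 1"
    unfolding d_def using \<alpha>_pos \<theta>p_le \<theta>_pos by (intro mult_left_mono) auto
  then have "(1 + exp \<alpha>) * p < (1 + exp \<alpha>) * 1"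
    using d_eq by simp
  then show ?thesis
    using exp_gt_zero[of \<alpha>] by (subst (asm) mult_less_cancel_left_pos) (auto intro: add_pos_pos)
qed

lemma random_variable_Z [measurable]: "random_variable (count_space UNIV) (Z i)"
  using indep_Z by (simp add: indep_vars_def2)

lemma sample_mean_measurable [measurable]: "random_variable borel (sample_mean Z n)"
  unfolding sample_mean_def by measurable

lemma estimator_measurable [measurable]: "random_variable borel (estimator c \<alpha> \<theta>p Z n)"
  unfolding estimator_def by measurable

lemma D_measurable [measurable]: "random_variable borel (D n)"
  unfolding D_def by measurable

lemma W_measurable [measurable]: "random_variable borel (W n)"
  unfolding W_def by measurable

lemma expectation_Z: "expectation (\<lambda>\<omega>. f (Z i \<omega>)) = (1 - p) * f 0 + p * f 1"
  using prob_Z[of i] Z01 by (intro expectation_zero_one) (auto simp: p_def)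

lemma AE_sample_mean: "AE \<omega> in M. (\<lambda>n. sample_mean Z n \<omega>) \<longlonglongrightarrow> p"
  unfolding sample_mean_def
proof (rule strong_law_bounded)
  show "indep_vars (\<lambda>_. borel) (\<lambda>i \<omega>. real (Z i \<omega>)) UNIV"
    by (rule indep_vars_compose2[OF indep_Z]) simp
  show "AE \<omega> in M. real (Z i \<omega>) \<in> {0..1}" for i
  proof (rule AE_I2)
    fix \<omega> assume "\<omega> \<in> space M"
    then show "real (Z i \<omega>) \<in> {0..1}" using Z01[of \<omega> i] by auto
  qed
  show "expectation (\<lambda>\<omega>. real (Z i \<omega>)) = p" for i
    using expectation_Z[of real i] by simp
qed

lemma AE_D: "AE \<omega> in M. (\<lambda>n. D n \<omega>) \<longlonglongrightarrow> d"
  using AE_sample_mean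
proof eventually_elim
  case (elim \<omega>)
  show ?case unfolding D_def d_eq[symmetric] by (intro tendsto_intros elim)
qed

lemma \<theta>_d: "\<theta>p * (exp \<alpha> - 1) = \<theta> * d"
  using \<theta>_pos by (simp add: d_def)

lemma estimator_eq: "D n \<omega> \<noteq> 0 \<Longrightarrow> estimator c \<alpha> \<theta>p Z n \<omega> = \<theta> * d / D n \<omega>"
  by (simp add: estimator_def D_def \<theta>_d)

theorem AE_estimator: "AE \<omega> in M. (\<lambda>n. estimator c \<alpha> \<theta>p Z n \<omega>) \<longlonglongrightarrow> \<theta>"
  using AE_D
proof eventually_elim
  case (elim \<omega>)
  have "(\<lambda>n. \<theta> * d / D n \<omega>) \<longlonglongrightarrow> \<theta> * d / d"
    using d_pos by (intro tendsto_intros elim) simp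
  moreover have "eventually (\<lambda>n. \<theta> * d / D n \<omega> = estimator c \<alpha> \<theta>p Z n \<omega>) sequentially"
    using order_tendstoD(1)[OF elim d_pos] by eventually_elim (simp add: estimator_eq)
  ultimately show ?case
    using d_pos by (simp add: tendsto_cong)
qed

theorem estimator_consistent: "converges_in_probability M (estimator c \<alpha> \<theta>p Z) \<theta>"
  unfolding converges_in_probability_def
proof (intro allI impI)
  fix \<epsilon> :: real assume "\<epsilon> > 0"
  show "(\<lambda>n. prob {\<omega> \<in> space M. \<bar>estimator c \<alpha> \<theta>p Z n \<omega> - \<theta>\<bar> > \<epsilon>}) \<longlonglongrightarrow> 0"
  proof (rule AE_eventually_not_imp_prob_tendsto_0)
    show "AE \<omega> in M. eventually
            (\<lambda>n. \<omega> \<notin> {\<omega> \<in> space M. \<bar>estimator c \<alpha> \<theta>p Z n \<omega> - \<theta>\<bar> > \<epsilon>}) sequentially"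
      using AE_estimator
    proof eventually_elim
      case (elim \<omega>)
      from tendstoD[OF this \<open>\<epsilon> > 0\<close>] show ?case
        by eventually_elim (simp add: dist_real_def)
    qed
  qed measurable
qed

lemma clt_W: "weak_conv_m (\<lambda>n. distr M borel (W n)) std_normal_distribution"
  unfolding W_def[abs_def]
proof (rule central_limit_theorem_zero_mean)
  show "indep_vars (\<lambda>_. borel) (\<lambda>i \<omega>. p - real (Z i \<omega>)) UNIV"
    by (rule indep_vars_compose2[OF indep_Z]) simp
  show mean: "expectation (\<lambda>\<omega>. p - real (Z i \<omega>)) = 0" for i
    using expectation_Z[of "\<lambda>z. p - real z" i] by (simp add: algebra_simps)
  show "sqrt (p * (1 - p)) > 0"
    using p_pos p_less_1 by simp
  show "integrable M (\<lambda>\<omega>. (p - real (Z i \<omega>))\<^sup>2)" for i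
  proof (rule integrable_const_bound[where B = 1])
    show "AE \<omega> in M. norm ((p - real (Z i \<omega>))\<^sup>2) \<le> 1"
    proof (rule AE_I2)
      fix \<omega> assume "\<omega> \<in> space M"
      then have "\<bar>p - real (Z i \<omega>)\<bar> \<le> 1"
        using Z01[of \<omega> i] p_pos p_less_1 by auto
      then show "norm ((p - real (Z i \<omega>))\<^sup>2) \<le> 1"
        by (simp add: abs_square_le_1)
    qed
  qed measurable
  show "variance (\<lambda>\<omega>. p - real (Z i \<omega>)) = (sqrt (p * (1 - p)))\<^sup>2" for i
  proof -
    have "variance (\<lambda>\<omega>. p - real (Z i \<omega>)) = (1 - p) * p\<^sup>2 + p * (p - 1)\<^sup>2"
      unfolding mean using expectation_Z[of "\<lambda>z. (p - real z)\<^sup>2" i] by simp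
    also have "\<dots> = p * (1 - p)"
      by (simp add: power2_eq_square algebra_simps)
    finally show ?thesis
      using p_pos p_less_1 by simp
  qed
  \<comment> \<open>The law of a view is determined by its success probability, which does not depend on \<open>i\<close>.\<close>
  show "distr M borel (\<lambda>\<omega>. p - real (Z i \<omega>)) = distr M borel (\<lambda>\<omega>. p - real (Z 0 \<omega>))" for i
  proof (rule measure_eqI)
    fix A assume "A \<in> sets (distr M borel (\<lambda>\<omega>. p - real (Z i \<omega>)))"
    then have A [measurable]: "A \<in> sets borel" by simp
    have "prob ((\<lambda>\<omega>. p - real (Z j \<omega>)) -` A \<inter> space M)
            = (1 - p) * indicator A (p - 0) + p * indicator A (p - 1)" for j
    proof -
      have "prob ((\<lambda>\<omega>. p - real (Z j \<omega>)) -` A \<inter> space M)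
              = expectation (indicator ((\<lambda>\<omega>. p - real (Z j \<omega>)) -` A \<inter> space M))"
        by simp
      also have "\<dots> = expectation (\<lambda>\<omega>. indicator A (p - real (Z j \<omega>)))"
        by (intro Bochner_Integration.integral_cong) (auto simp: indicator_def)
      also have "\<dots> = (1 - p) * indicator A (p - 0) + p * indicator A (p - 1)"
        using expectation_Z[of "\<lambda>z. indicator A (p - real z)" j] by simp
      finally show ?thesis .
    qed
    then show "emeasure (distr M borel (\<lambda>\<omega>. p - real (Z i \<omega>))) A
                 = emeasure (distr M borel (\<lambda>\<omega>. p - real (Z 0 \<omega>))) A"
      by (simp add: emeasure_distr emeasure_eq_measure)
  qed simp
qed

section \<open>The limit law of the scaled error\<close>

text \<open>The standard deviation of \<open>(1 + exp \<alpha>) * Z\<^sub>i\<close>.\<close>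

definition s :: real where "s = (1 + exp \<alpha>) * sqrt (p * (1 - p))"

lemma s_pos: "s > 0"
  using p_pos p_less_1 exp_gt_zero[of \<alpha>] unfolding s_def by (intro mult_pos_pos) (auto simp: add_pos_pos)

lemma D_W:
  assumes "n > 0"
  shows "D n \<omega> = d - s * W n \<omega> / sqrt (real n)"
proof -
  define \<sigma> where "\<sigma> = sqrt (p * (1 - p))"
  have \<sigma>: "\<sigma> > 0" using p_pos p_less_1 by (simp add: \<sigma>_def)
  have "W n \<omega> = real n * (p - sample_mean Z n \<omega>) / (sqrt (real n) * \<sigma>)"
    using assms \<sigma> unfolding W_def \<sigma>_def[symmetric]
    by (simp add: sum_subtractf sample_mean_def real_sqrt_mult right_diff_distrib)
  also have "\<dots> = sqrt (real n) * (p - sample_mean Z n \<omega>) / \<sigma>"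
    using assms \<sigma> by (simp add: divide_simps)
  finally have "s * W n \<omega> / sqrt (real n) = (1 + exp \<alpha>) * (p - sample_mean Z n \<omega>)"
    using assms \<sigma> by (simp add: s_def \<sigma>_def[symmetric])
  then show ?thesis
    by (simp add: D_def d_eq[symmetric] algebra_simps)
qed

lemma scaled_error:
  assumes "n > 0" "D n \<omega> \<noteq> 0"
  shows "sqrt (real n) * (estimator c \<alpha> \<theta>p Z n \<omega> - \<theta>) = \<theta> * s * W n \<omega> / D n \<omega>"
proof -
  have "estimator c \<alpha> \<theta>p Z n \<omega> - \<theta> = \<theta> * (d - D n \<omega>) / D n \<omega>"
    using assms(2) by (simp add: estimator_eq field_simps)
  then show ?thesis
    using assms by (simp add: D_W[OF assms(1)])
qed

text \<open>
  The scaled error is a ratio of two affine functions of \<open>W\<^sub>n\<close>. Where its denominator is positive,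
  bounding it by \<open>x\<close> is a linear inequality in \<open>W\<^sub>n\<close>, whose leading coefficient
  is positive for large \<open>n\<close>.
\<close>

lemma scaled_error_le_iff:
  assumes n: "n > 0" and D: "D n \<omega> > 0" and x: "\<theta> + x / sqrt (real n) > 0"
  shows "sqrt (real n) * (estimator c \<alpha> \<theta>p Z n \<omega> - \<theta>) \<le> x
           \<longleftrightarrow> W n \<omega> \<le> x * d / (s * (\<theta> + x / sqrt (real n)))"
proof -
  have "sqrt (real n) * (estimator c \<alpha> \<theta>p Z n \<omega> - \<theta>) \<le> x \<longleftrightarrow> \<theta> * s * W n \<omega> \<le> x * D n \<omega>"
    using D by (simp add: scaled_error[OF n] pos_divide_le_eq)
  also have "\<dots> \<longleftrightarrow> W n \<omega> * (s * (\<theta> + x / sqrt (real n))) \<le> x * d"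
    by (simp add: D_W[OF n] algebra_simps)
  also have "\<dots> \<longleftrightarrow> W n \<omega> \<le> x * d / (s * (\<theta> + x / sqrt (real n)))"
    using x s_pos by (simp add: pos_le_divide_eq)
  finally show ?thesis .
qed

lemma asymptotic_variance_eq: "asymptotic_variance \<alpha> \<theta> \<theta>p = (\<theta> * s / d)\<^sup>2"
proof -
  have "s\<^sup>2 = (1 + exp \<alpha>)\<^sup>2 * (p * (1 - p))"
    using p_pos p_less_1 by (simp add: s_def power_mult_distrib)
  also have "\<dots> = ((1 + exp \<alpha>) * p) * ((1 + exp \<alpha>) - (1 + exp \<alpha>) * p)"
    by (simp add: power2_eq_square algebra_simps)
  also have "(1 + exp \<alpha>) * p = 1 + d"
    using d_eq by simp
  finally have s2: "s\<^sup>2 = (1 + d) * (exp \<alpha> - d)"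
    by simp
  have "asymptotic_variance \<alpha> \<theta> \<theta>p
          = \<theta> ^ 4 / \<theta>p ^ 2 * (1 / (exp \<alpha> - 1) ^ 2) * ((1 + d) * (exp \<alpha> - d))"
    by (simp add: asymptotic_variance_def d_def)
  also have "\<theta> ^ 4 / \<theta>p ^ 2 * (1 / (exp \<alpha> - 1) ^ 2) = (\<theta> / d)\<^sup>2"
    by (simp add: d_def power_divide power_mult_distrib power2_eq_square power4_eq_xxxx mult_ac)
  finally show ?thesis
    by (simp add: s2 power_divide power_mult_distrib)
qed

theorem estimator_asymptotically_normal:
  "weak_conv_m (\<lambda>n. distr M borel (\<lambda>\<omega>. sqrt (real n) * (estimator c \<alpha> \<theta>p Z n \<omega> - \<theta>)))
     (normal_law 0 (asymptotic_variance \<alpha> \<theta> \<theta>p))"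
  unfolding weak_conv_m_def weak_conv_def
proof (intro allI impI)
  fix x :: real
  let ?Y = "\<lambda>n \<omega>. sqrt (real n) * (estimator c \<alpha> \<theta>p Z n \<omega> - \<theta>)"
  let ?t = "\<lambda>n. x * d / (s * (\<theta> + x / sqrt (real n)))"
  let ?N = "\<lambda>n. {\<omega> \<in> space M. D n \<omega> \<le> 0}"
  \<comment> \<open>The distribution function of the scaled error at \<open>x\<close> is compared with that of \<open>W\<^sub>n\<close> at
    the threshold \<open>?t n\<close>; the two events can differ only on \<open>?N n\<close>.\<close>
  have "filterlim (\<lambda>n. sqrt (real n)) at_top sequentially"
    by (rule filterlim_compose[OF sqrt_at_top filterlim_real_sequentially])
  then have shift: "(\<lambda>n. \<theta> + x / sqrt (real n)) \<longlonglongrightarrow> \<theta> + 0"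
    by (intro tendsto_intros real_tendsto_divide_at_top[OF tendsto_const])
  then have "?t \<longlonglongrightarrow> x * d / (s * (\<theta> + 0))"
    using s_pos \<theta>_pos by (intro tendsto_divide tendsto_mult tendsto_const) auto
  then have W_lim: "(\<lambda>n. cdf (distr M borel (W n)) (?t n))
                      \<longlonglongrightarrow> cdf std_normal_distribution (x * d / (s * (\<theta> + 0)))"
    by (intro weak_conv_m_cdf_tendsto[OF clt_W]) (auto intro: isCont_cdf_std_normal)
  have N_lim: "(\<lambda>n. prob (?N n)) \<longlonglongrightarrow> 0"
  proof (rule AE_eventually_not_imp_prob_tendsto_0)
    show "AE \<omega> in M. eventually (\<lambda>n. \<omega> \<notin> ?N n) sequentially"
      using AE_D
    proof eventually_elim
      case (elim \<omega>)
      from order_tendstoD(1)[OF this d_pos] show ?case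
        by eventually_elim simp
    qed
  qed measurable
  have "(\<lambda>n. cdf (distr M borel (?Y n)) x - cdf (distr M borel (W n)) (?t n)) \<longlonglongrightarrow> 0"
  proof (rule Lim_null_comparison[OF _ N_lim])
    have "eventually (\<lambda>n. \<theta> + x / sqrt (real n) > 0) sequentially"
      using order_tendstoD(1)[OF shift, of 0] \<theta>_pos by simp
    then show "eventually (\<lambda>n. norm (cdf (distr M borel (?Y n)) x - cdf (distr M borel (W n)) (?t n))
                 \<le> prob (?N n)) sequentially"
      using eventually_gt_at_top[of 0]
    proof eventually_elim
      case (elim n)
      let ?A = "{\<omega> \<in> space M. ?Y n \<omega> \<le> x}" and ?B = "{\<omega> \<in> space M. W n \<omega> \<le> ?t n}"
      have cdfs: "cdf (distr M borel (?Y n)) x = prob ?A"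
                 "cdf (distr M borel (W n)) (?t n) = prob ?B"
        by (auto simp: cdf_def measure_distr intro!: arg_cong[where f = prob])
      have iff: "\<omega> \<in> ?A \<longleftrightarrow> \<omega> \<in> ?B" if "\<omega> \<notin> ?N n" for \<omega>
        using scaled_error_le_iff[OF elim(2) _ elim(1), of \<omega>] that by auto
      have "prob ?A \<le> prob (?B \<union> ?N n)" "prob ?B \<le> prob (?A \<union> ?N n)"
        using iff by (auto intro!: finite_measure_mono)
      moreover have "prob (?B \<union> ?N n) \<le> prob ?B + prob (?N n)"
                    "prob (?A \<union> ?N n) \<le> prob ?A + prob (?N n)"
        by (intro measure_Un_le; measurable)+
      ultimately show ?case
        unfolding cdfs by simp
    qed
  qed
  from tendsto_add[OF this W_lim]
  have "(\<lambda>n. cdf (distr M borel (?Y n)) x) \<longlonglongrightarrow> cdf std_normal_distribution (x / (\<theta> * s / d))"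
    by (simp add: mult.commute)
  then show "(\<lambda>n. cdf (distr M borel (?Y n)) x)
               \<longlonglongrightarrow> cdf (normal_law 0 (asymptotic_variance \<alpha> \<theta> \<theta>p)) x"
    using \<theta>_pos s_pos d_pos by (simp add: asymptotic_variance_eq cdf_normal_law)
qed

end

section \<open>Uniform observations\<close>

theorem proposition4:
  fixes M :: "'a measure"
    and X :: "nat \<Rightarrow> 'a \<Rightarrow> real" and Z :: "nat \<Rightarrow> 'a \<Rightarrow> nat"
    and \<alpha> \<theta>p \<theta>0 c :: real
  assumes "prob_space M"
    and "\<alpha> > 0" and "\<theta>p > 0" and "\<theta>0 > 0"
    and indep: "prob_space.indep_vars M (\<lambda>_. borel \<Otimes>\<^sub>M count_space UNIV)
                  (\<lambda>i \<omega>. (X i \<omega>, Z i \<omega>)) UNIV"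
    and unif: "\<And>i. distr M borel (X i) = uniform_measure lborel {0..\<theta>0}"
    and Z01: "\<And>i \<omega>. \<omega> \<in> space M \<Longrightarrow> Z i \<omega> \<in> {0, 1}"
    and chan: "\<And>i z. z \<in> {0, 1} \<Longrightarrow>
                 AE \<omega> in M. real_cond_exp M (vimage_algebra (space M) (X i) borel)
                               (indicator {\<omega> \<in> space M. Z i \<omega> = z}) \<omega>
                             = channel \<alpha> \<theta>p (X i \<omega>) z"
  shows "(AE \<omega> in M. (\<lambda>n. estimator c \<alpha> \<theta>p Z n \<omega>) \<longlonglongrightarrow> max \<theta>0 \<theta>p) \<and>
         (\<theta>p \<le> \<theta>0 \<longrightarrow>
            converges_in_probability M (estimator c \<alpha> \<theta>p Z) \<theta>0 \<and>
            weak_conv_m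
              (\<lambda>n. distr M borel (\<lambda>\<omega>. sqrt (real n) * (estimator c \<alpha> \<theta>p Z n \<omega> - \<theta>0)))
              (normal_law 0 (asymptotic_variance \<alpha> \<theta>0 \<theta>p)))"
proof -
  interpret prob_space M by fact
  have XZ [measurable]: "(\<lambda>\<omega>. (X i \<omega>, Z i \<omega>)) \<in> measurable M (borel \<Otimes>\<^sub>M count_space UNIV)" for i
    using indep by (simp add: indep_vars_def2)
  have X [measurable]: "random_variable borel (X i)" for i
    using measurable_compose[OF XZ measurable_fst] by simp
  have Z [measurable]: "random_variable (count_space UNIV) (Z i)" for i
    using measurable_compose[OF XZ measurable_snd] by simp
  interpret private_bits M Z \<alpha> \<theta>p "max \<theta>0 \<theta>p" c
  proof
    show "indep_vars (\<lambda>_. count_space UNIV) Z UNIV"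
      using indep_vars_compose2[OF indep, of "\<lambda>_. snd" "\<lambda>_. count_space UNIV"] by simp
    have "min \<theta>0 \<theta>p / \<theta>0 = \<theta>p / max \<theta>0 \<theta>p"
      using \<open>\<theta>p > 0\<close> \<open>\<theta>0 > 0\<close> by (simp add: min_def max_def)
    moreover have "prob {\<omega> \<in> space M. Z i \<omega> = 1}
                     = (1 + (exp \<alpha> - 1) * (min \<theta>0 \<theta>p / \<theta>0)) / (1 + exp \<alpha>)" for i
      by (rule prob_one_channel[OF X Z unif]) (use \<open>\<theta>0 > 0\<close> \<open>\<theta>p > 0\<close> chan[of 1 i] in simp_all)
    ultimately show "prob {\<omega> \<in> space M. Z i \<omega> = 1}
                 = (1 + (exp \<alpha> - 1) * (\<theta>p / max \<theta>0 \<theta>p)) / (1 + exp \<alpha>)" for i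
      by simp
  qed (use Z01 \<open>\<alpha> > 0\<close> \<open>\<theta>p > 0\<close> in auto)
  show ?thesis
    using AE_estimator estimator_consistent estimator_asymptotically_normal
    by (auto simp: max_absorb1)
qed

end
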